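(* Consider an asynchronous system of $n=7f+1$ replicas, at most $f$ of which may be Byzantine, and let $n_1=5f+1$. Then the MBC-L protocol ("MBC with learners", defined in the context), with $n_1=5f+1$ active replicas and $2f$ learners, is a (Byzantine) reliable broadcast protocol, i.e. it satisfies the following, where "replica" refers to active replicas and learners alike: (Validity) if a correct replica $p$ broadcasts a message $m$, then $p$ eventually delivers $m$; (Agreement) if some correct replica delivers a message $m$, then every correct replica eventually delivers $m$; (Integrity) for any message $m$, every correct replica delivers $m$ at most once; moreover, if the sender is correct, then $m$ was previously broadcast by the sender.
   Context: System model. There are $n=7f+1$ replicas, at most $f$ of which may exhibit arbitrary behavior (Byzantine failures); the others are correct. The system is purely asynchronous: no timing assumptions are made on message processing or transmission delays. In reliable broadcast, a sender $p_{sender}$ (one of the replicas) broadcasts a message to all other replicas in the group. In MBC-L, $n_1=5f+1$ of the replicas are active replicas and the other $2f$ are learners; the choice of the active replicas is arbitrary. The $\mathsf{init}$/$\mathsf{witness}$ part of the protocol (steps 1–4) is run among the active replicas; learners take no active part in it and only learn the result. Tools. A $(k,n_1)$ maximum distance separable (MDS) erasure coding scheme encodes $k$ data blocks into $n_1\ge k$ coded blocks such that all blocks can be recovered from any $k$ of the coded blocks by a decode algorithm. A Merkle tree is built, using a collision-resistant hash function, over $n_1$ blocks $l_0,\dots,l_{n_1-1}$; $h$ denotes its root and $b_j$ its $j$-th branch. A message carrying $(h,b_j,l_j)$ is valid if $b_j$ is a valid Merkle tree branch for the Merkle tree root $h$ and the data block $l_j$. The MBC-L protocol (code for replica $p_i$).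 1. Upon input $m$ (if $p_{sender}=p_i$): let $active\_rep$ be a set of $n_1=5f+1$ active replicas; let $l_j$ be the $j$-th block of the $(n_1-2f,n_1)$ erasure coding scheme applied to $m$, and let $h$ be the root of the Merkle tree for the $n_1$ blocks; send $\mathsf{init}(h,b_j,l_j,active\_rep)$ to each (active) $p_j$, where $b_j$ is the $j$-th Merkle tree branch. 2. Upon receiving $\mathsf{init}(h,b_i,l_i,active\_rep)$ from $p_{sender}$: broadcast $\mathsf{witness}(h,b_i,l_i,active\_rep)$. 3. Upon receiving $n_1-2f$ valid messages $\mathsf{witness}(h,b_j,l_j,active\_rep)$: interpolate all blocks $\{l'_j\}$ from the $n_1-2f$ blocks and recompute the Merkle root $h'$; if $h'\neq h$, abort. If $\mathsf{witness}(h,b_i,l_i,active\_rep)$ has not been sent, broadcast $\mathsf{witness}(h,b_i,l_i,active\_rep)$. 4. Upon receiving $n_1-f$ valid messages $\mathsf{witness}(h,b_j,l_j,active\_rep)$: send $\mathsf{ready}(h,b_i,l_i)$ to the $2f$ learners, decode $m$ from any $n_1-2f$ of the blocks $l_j$, and deliver $m$. 5. (Learners) Upon receiving $n_1-f$ valid messages $\mathsf{ready}(h,\cdot,\cdot)$ from active replicas: decode $m$ from the blocks $\{l_j\}$ and deliver $m$. *)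

theory Defs
  imports Main
begin

section \<open>Merkle trees\<close>

datatype ('b, 'h) hash_input = Leaf 'b | Node 'h 'h

type_synonym ('b, 'h) hash_fun = "('b, 'h) hash_input \<Rightarrow> 'h"

text \<open>The tree over a list of blocks splits the list in half at every inner node; the value for
  the empty list is irrelevant.\<close>

fun merkle_root :: "('b, 'h) hash_fun \<Rightarrow> 'b list \<Rightarrow> 'h" where
  "merkle_root H [] = undefined"
| "merkle_root H [l] = H (Leaf l)"
| "merkle_root H (l # l' # ls) =
     (let xs = l # l' # ls; c = length xs div 2
      in H (Node (merkle_root H (take c xs)) (merkle_root H (drop c xs))))"

text \<open>The branch of position \<open>j\<close> lists the siblings on the path from the root to leaf \<open>j\<close>.\<close>

fun merkle_branch :: "('b, 'h) hash_fun \<Rightarrow> 'b list \<Rightarrow> nat \<Rightarrow> 'h list" where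
  "merkle_branch H [] j = []"
| "merkle_branch H [l] j = []"
| "merkle_branch H (l # l' # ls) j =
     (let xs = l # l' # ls; c = length xs div 2
      in if j < c then merkle_root H (drop c xs) # merkle_branch H (take c xs) j
         else merkle_root H (take c xs) # merkle_branch H (drop c xs) (j - c))"

text \<open>Root of a tree with \<open>N\<close> leaves recomputed from the block \<open>l\<close> at position \<open>j\<close> and a
  branch; \<open>None\<close> if the length of the branch does not fit.\<close>

fun branch_root :: "('b, 'h) hash_fun \<Rightarrow> nat \<Rightarrow> nat \<Rightarrow> 'h list \<Rightarrow> 'b \<Rightarrow> 'h option" where
  "branch_root H N j [] l = (if N = 1 then Some (H (Leaf l)) else None)"
| "branch_root H N j (x # xs) l =
     (if N \<le> 1 then None
      else if j < N div 2
      then map_option (\<lambda>y. H (Node y x)) (branch_root H (N div 2) j xs l)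
      else map_option (\<lambda>y. H (Node x y)) (branch_root H (N - N div 2) (j - N div 2) xs l))"

definition valid_branch :: "('b, 'h) hash_fun \<Rightarrow> nat \<Rightarrow> 'h \<Rightarrow> nat \<Rightarrow> 'h list \<Rightarrow> 'b \<Rightarrow> bool" where
  "valid_branch H N h j b l \<longleftrightarrow> j < N \<and> branch_root H N j b l = Some h"

text \<open>The inputs on which the hash function is evaluated when a root is computed from all blocks,
  and when it is recomputed from a branch.\<close>

fun tree_inputs :: "('b, 'h) hash_fun \<Rightarrow> 'b list \<Rightarrow> ('b, 'h) hash_input set" where
  "tree_inputs H [] = {}"
| "tree_inputs H [l] = {Leaf l}"
| "tree_inputs H (l # l' # ls) =
     (let xs = l # l' # ls; c = length xs div 2
      in insert (Node (merkle_root H (take c xs)) (merkle_root H (drop c xs)))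
           (tree_inputs H (take c xs) \<union> tree_inputs H (drop c xs)))"

fun branch_inputs ::
  "('b, 'h) hash_fun \<Rightarrow> nat \<Rightarrow> nat \<Rightarrow> 'h list \<Rightarrow> 'b \<Rightarrow> ('b, 'h) hash_input set" where
  "branch_inputs H N j [] l = (if N = 1 then {Leaf l} else {})"
| "branch_inputs H N j (x # xs) l =
     (if N \<le> 1 then {}
      else if j < N div 2
      then (\<lambda>y. Node y x) ` set_option (branch_root H (N div 2) j xs l)
             \<union> branch_inputs H (N div 2) j xs l
      else (\<lambda>y. Node x y) ` set_option (branch_root H (N - N div 2) (j - N div 2) xs l)
             \<union> branch_inputs H (N - N div 2) (j - N div 2) xs l)"


section \<open>Erasure coding\<close>

text \<open>The decoder gets a partial map from positions to blocks. It is also run on blocks that do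
  not belong to any codeword (supplied by a faulty sender); it then returns some \<open>k\<close> data blocks.\<close>

definition mds_code ::
  "nat \<Rightarrow> nat \<Rightarrow> ('b list \<Rightarrow> 'b list) \<Rightarrow> ((nat \<rightharpoonup> 'b) \<Rightarrow> 'b list) \<Rightarrow> bool" where
  "mds_code k N enc dec \<longleftrightarrow>
     k \<le> N \<and>
     (\<forall>m. length m = k \<longrightarrow> length (enc m) = N) \<and>
     (\<forall>m J. length m = k \<and> J \<subseteq> {..<N} \<and> card J = k
        \<longrightarrow> dec ((\<lambda>j. Some (enc m ! j)) |` J) = m) \<and>
     (\<forall>B. dom B \<subseteq> {..<N} \<and> card (dom B) = k \<longrightarrow> length (dec B) = k)"


section \<open>Reliable broadcast\<close>

text \<open>\<open>C\<close> is the set of correct replicas; \<open>bc t p\<close> is the set of messages broadcast by \<open>p\<close>, and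
  \<open>dl t p\<close> the sequence of messages delivered by \<open>p\<close>, up to time \<open>t\<close>.\<close>

definition rb_validity ::
  "'p set \<Rightarrow> (nat \<Rightarrow> 'p \<Rightarrow> 'm set) \<Rightarrow> (nat \<Rightarrow> 'p \<Rightarrow> 'm list) \<Rightarrow> bool" where
  "rb_validity C bc dl \<longleftrightarrow>
     (\<forall>p\<in>C. \<forall>m t. m \<in> bc t p \<longrightarrow> (\<exists>t'. m \<in> set (dl t' p)))"

definition rb_agreement :: "'p set \<Rightarrow> (nat \<Rightarrow> 'p \<Rightarrow> 'm list) \<Rightarrow> bool" where
  "rb_agreement C dl \<longleftrightarrow>
     (\<forall>p\<in>C. \<forall>m t. m \<in> set (dl t p) \<longrightarrow> (\<forall>q\<in>C. \<exists>t'. m \<in> set (dl t' q)))"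

definition rb_integrity ::
  "'p set \<Rightarrow> 'p \<Rightarrow> (nat \<Rightarrow> 'p \<Rightarrow> 'm set) \<Rightarrow> (nat \<Rightarrow> 'p \<Rightarrow> 'm list) \<Rightarrow> bool" where
  "rb_integrity C sndr bc dl \<longleftrightarrow>
     (\<forall>p\<in>C. \<forall>m t. count_list (dl t p) m \<le> 1 \<and>
        (sndr \<in> C \<and> m \<in> set (dl t p) \<longrightarrow> (\<exists>t'<t. m \<in> bc t' sndr)))"

definition reliable_broadcast ::
  "'p set \<Rightarrow> 'p \<Rightarrow> (nat \<Rightarrow> 'p \<Rightarrow> 'm set) \<Rightarrow> (nat \<Rightarrow> 'p \<Rightarrow> 'm list) \<Rightarrow> bool" where
  "reliable_broadcast C sndr bc dl \<longleftrightarrow>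
     rb_validity C bc dl \<and> rb_agreement C dl \<and> rb_integrity C sndr bc dl"


section \<open>The protocol MBC-L\<close>

type_synonym replica = nat

text \<open>A broadcast message is given by its \<open>k\<close> data blocks.\<close>

record ('b, 'h) mbcl =
  num_replicas :: nat  \<comment> \<open>\<open>n\<close>\<close>
  num_active :: nat    \<comment> \<open>\<open>n\<^sub>1\<close>\<close>
  max_faulty :: nat    \<comment> \<open>\<open>f\<close>\<close>
  sender :: replica
  hash :: "('b, 'h) hash_fun"
  encode :: "'b list \<Rightarrow> 'b list"
  decode :: "(nat \<rightharpoonup> 'b) \<Rightarrow> 'b list"

definition replicas :: "('b, 'h) mbcl \<Rightarrow> replica set" where
  "replicas P = {..<num_replicas P}"

definition threshold :: "('b, 'h) mbcl \<Rightarrow> nat" where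
  "threshold P = num_active P - 2 * max_faulty P"

definition quorum :: "('b, 'h) mbcl \<Rightarrow> nat" where
  "quorum P = num_active P - max_faulty P"

definition active_set :: "('b, 'h) mbcl \<Rightarrow> replica set \<Rightarrow> bool" where
  "active_set P A \<longleftrightarrow> A \<subseteq> replicas P \<and> card A = num_active P"

text \<open>The active replicas of \<open>A\<close> are numbered \<open>0, \<dots>, n\<^sub>1 - 1\<close> in increasing order; block \<open>j\<close>
  belongs to the \<open>j\<close>-th of them.\<close>

definition position :: "replica set \<Rightarrow> replica \<Rightarrow> nat" where
  "position A p = card {q \<in> A. q < p}"

datatype ('b, 'h) message =
    Init 'h "'h list" 'b "replica set"
  | Witness 'h "'h list" 'b "replica set"
  | Ready 'h "'h list" 'b

text \<open>Progress of an active replica for a given root and active set; an inconsistent root aborts only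
  the processing of that root and active set.\<close>

datatype 'b phase = Waiting | Interpolated "'b list" | Aborted | Completed

text \<open>\<open>(p, q, M) \<in> sent s\<close>: \<open>p\<close> has sent \<open>M\<close> to \<open>q\<close>. Only distinct senders are ever counted, so
  a set suffices, and sending the same message a second time has no effect.
  \<open>delivered_roots s p\<close> contains the Merkle roots for which \<open>p\<close> has delivered a message.\<close>

record ('b, 'h) state =
  sent :: "(replica \<times> replica \<times> ('b, 'h) message) set"
  received :: "replica \<Rightarrow> (replica \<times> ('b, 'h) message) set"
  phase :: "replica \<Rightarrow> 'h \<Rightarrow> replica set \<Rightarrow> 'b phase"
  delivered_roots :: "replica \<Rightarrow> 'h set"
  broadcasts :: "replica \<Rightarrow> 'b list set"
  delivered :: "replica \<Rightarrow> 'b list list"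

definition initial_state :: "('b, 'h) state" where
  "initial_state =
     \<lparr>sent = {}, received = (\<lambda>_. {}), phase = (\<lambda>_ _ _. Waiting), delivered_roots = (\<lambda>_. {}),
      broadcasts = (\<lambda>_. {}), delivered = (\<lambda>_. [])\<rparr>"

definition multicast ::
  "replica \<Rightarrow> replica set \<Rightarrow> (replica \<Rightarrow> ('b, 'h) message) \<Rightarrow> ('b, 'h) state \<Rightarrow> ('b, 'h) state" where
  "multicast p Q M s = s\<lparr>sent := sent s \<union> (\<lambda>q. (p, q, M q)) ` Q\<rparr>"

definition set_phase ::
  "replica \<Rightarrow> 'h \<Rightarrow> replica set \<Rightarrow> 'b phase \<Rightarrow> ('b, 'h) state \<Rightarrow> ('b, 'h) state" where
  "set_phase p h A x s = s\<lparr>phase := (phase s)(p := (phase s p)(h := (phase s p h)(A := x)))\<rparr>"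

text \<open>A replica delivers at most once for the same root, even if it gets to delivery for several
  active sets (announced by a faulty sender), or as an active replica and as a learner.\<close>

definition deliver :: "replica \<Rightarrow> 'h \<Rightarrow> 'b list \<Rightarrow> ('b, 'h) state \<Rightarrow> ('b, 'h) state" where
  "deliver p h m s =
     (if h \<in> delivered_roots s p then s
      else s\<lparr>delivered_roots := (delivered_roots s)(p := insert h (delivered_roots s p)),
             delivered := (delivered s)(p := delivered s p @ [m])\<rparr>)"

text \<open>\<open>B\<close> collects blocks from valid messages of exactly \<open>c\<close> distinct members of \<open>A\<close>, where
  \<open>R q b l\<close> means that a message with branch \<open>b\<close> and block \<open>l\<close> from \<open>q\<close> is available.\<close>

definition collected ::
  "('b, 'h) mbcl \<Rightarrow> (replica \<Rightarrow> 'h list \<Rightarrow> 'b \<Rightarrow> bool) \<Rightarrow> 'h \<Rightarrow> replica set \<Rightarrow> nat \<Rightarrow> (nat \<rightharpoonup> 'b) \<Rightarrow> bool"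
  where
  "collected P R h A c B \<longleftrightarrow>
     (\<exists>Q\<subseteq>A. card Q = c \<and> dom B = position A ` Q \<and>
        (\<forall>q\<in>Q. \<exists>b l. R q b l \<and> valid_branch (hash P) (num_active P) h (position A q) b l \<and>
           B (position A q) = Some l))"

definition witness_blocks ::
  "('b, 'h) mbcl \<Rightarrow> ('b, 'h) state \<Rightarrow> replica \<Rightarrow> 'h \<Rightarrow> replica set \<Rightarrow> nat \<Rightarrow> (nat \<rightharpoonup> 'b) \<Rightarrow> bool" where
  "witness_blocks P s p h A =
     collected P (\<lambda>q b l. (q, Witness h b l A) \<in> received s p) h A"

definition ready_blocks ::
  "('b, 'h) mbcl \<Rightarrow> ('b, 'h) state \<Rightarrow> replica \<Rightarrow> 'h \<Rightarrow> replica set \<Rightarrow> nat \<Rightarrow> (nat \<rightharpoonup> 'b) \<Rightarrow> bool" where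
  "ready_blocks P s p h A =
     collected P (\<lambda>q b l. (q, Ready h b l) \<in> received s p) h A"

definition decoded :: "('b, 'h) mbcl \<Rightarrow> (nat \<rightharpoonup> 'b) \<Rightarrow> 'b list \<Rightarrow> bool" where
  "decoded P B m \<longleftrightarrow> (\<exists>D\<subseteq>dom B. card D = threshold P \<and> m = decode P (B |` D))"

definition broadcast_step ::
  "('b, 'h) mbcl \<Rightarrow> replica \<Rightarrow> 'b list \<Rightarrow> replica set \<Rightarrow> ('b, 'h) state \<Rightarrow> ('b, 'h) state \<Rightarrow> bool" where
  "broadcast_step P p m A s s' \<longleftrightarrow>
     p = sender P \<and> length m = threshold P \<and> active_set P A \<and>
     (let ls = encode P m; h = merkle_root (hash P) ls
      in s' = multicast p A
                (\<lambda>q. Init h (merkle_branch (hash P) ls (position A q)) (ls ! position A q) A)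
                (s\<lparr>broadcasts := (broadcasts s)(p := insert m (broadcasts s p))\<rparr>))"

definition witness_step ::
  "('b, 'h) mbcl \<Rightarrow> replica \<Rightarrow> 'h \<Rightarrow> 'h list \<Rightarrow> 'b \<Rightarrow> replica set \<Rightarrow> ('b, 'h) state \<Rightarrow> ('b, 'h) state \<Rightarrow> bool"
  where
  "witness_step P p h b l A s s' \<longleftrightarrow>
     active_set P A \<and> p \<in> A \<and> (sender P, Init h b l A) \<in> received s p \<and>
     s' = multicast p A (\<lambda>_. Witness h b l A) s"

definition interpolate_step ::
  "('b, 'h) mbcl \<Rightarrow> replica \<Rightarrow> 'h \<Rightarrow> replica set \<Rightarrow> ('b, 'h) state \<Rightarrow> ('b, 'h) state \<Rightarrow> bool" where
  "interpolate_step P p h A s s' \<longleftrightarrow>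
     active_set P A \<and> p \<in> A \<and> phase s p h A = Waiting \<and>
     (\<exists>B. witness_blocks P s p h A (threshold P) B \<and>
        (let ls = encode P (decode P B); i = position A p
         in if merkle_root (hash P) ls = h
            then s' = multicast p A (\<lambda>_. Witness h (merkle_branch (hash P) ls i) (ls ! i) A)
                        (set_phase p h A (Interpolated ls) s)
            else s' = set_phase p h A Aborted s))"

definition ready_step ::
  "('b, 'h) mbcl \<Rightarrow> replica \<Rightarrow> 'h \<Rightarrow> replica set \<Rightarrow> ('b, 'h) state \<Rightarrow> ('b, 'h) state \<Rightarrow> bool" where
  "ready_step P p h A s s' \<longleftrightarrow>
     active_set P A \<and> p \<in> A \<and>
     (\<exists>ls B m. phase s p h A = Interpolated ls \<and>
        witness_blocks P s p h A (quorum P) B \<and> decoded P B m \<and>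
        (let i = position A p
         in s' = deliver p h m
                   (multicast p (replicas P - A)
                     (\<lambda>_. Ready h (merkle_branch (hash P) ls i) (ls ! i))
                     (set_phase p h A Completed s))))"

text \<open>A \<open>Ready\<close> message does not carry the active set, so a learner accepts valid messages from
  sufficiently many members of any possible active set that does not contain the learner.\<close>

definition learn_step ::
  "('b, 'h) mbcl \<Rightarrow> replica \<Rightarrow> 'h \<Rightarrow> ('b, 'h) state \<Rightarrow> ('b, 'h) state \<Rightarrow> bool" where
  "learn_step P p h s s' \<longleftrightarrow>
     h \<notin> delivered_roots s p \<and>
     (\<exists>A B m. active_set P A \<and> p \<in> replicas P - A \<and>
        ready_blocks P s p h A (quorum P) B \<and> decoded P B m \<and> s' = deliver p h m s)"

definition receive_step ::
  "replica \<Rightarrow> replica \<Rightarrow> ('b, 'h) message \<Rightarrow> ('b, 'h) state \<Rightarrow> ('b, 'h) state \<Rightarrow> bool" where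
  "receive_step p q M s s' \<longleftrightarrow>
     (p, q, M) \<in> sent s \<and>
     s' = s\<lparr>received := (received s)(q := insert (p, M) (received s q))\<rparr>"

text \<open>A faulty replica may send anything to anyone, but only under its own name.\<close>

definition byzantine_step ::
  "replica \<Rightarrow> ('b, 'h) state \<Rightarrow> ('b, 'h) state \<Rightarrow> bool" where
  "byzantine_step p s s' \<longleftrightarrow> (\<exists>q M. s' = s\<lparr>sent := insert (p, q, M) (sent s)\<rparr>)"

definition correct :: "('b, 'h) mbcl \<Rightarrow> replica set \<Rightarrow> replica set" where
  "correct P F = replicas P - F"

definition protocol_step ::
  "('b, 'h) mbcl \<Rightarrow> replica \<Rightarrow> ('b, 'h) state \<Rightarrow> ('b, 'h) state \<Rightarrow> bool" where
  "protocol_step P p s s' \<longleftrightarrow>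
     (\<exists>m A. broadcast_step P p m A s s') \<or>
     (\<exists>h b l A. witness_step P p h b l A s s') \<or>
     (\<exists>h A. interpolate_step P p h A s s') \<or>
     (\<exists>h A. ready_step P p h A s s') \<or>
     (\<exists>h. learn_step P p h s s')"

definition system_step ::
  "('b, 'h) mbcl \<Rightarrow> replica set \<Rightarrow> ('b, 'h) state \<Rightarrow> ('b, 'h) state \<Rightarrow> bool" where
  "system_step P F s s' \<longleftrightarrow>
     (\<exists>p\<in>correct P F. protocol_step P p s s') \<or>
     (\<exists>p\<in>F. byzantine_step p s s') \<or>
     (\<exists>p q M. receive_step p q M s s') \<or>
     s' = s"

definition weakly_fair :: "('s \<Rightarrow> 's \<Rightarrow> bool) \<Rightarrow> (nat \<Rightarrow> 's) \<Rightarrow> bool" where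
  "weakly_fair R r \<longleftrightarrow>
     (\<forall>t. (\<forall>t'\<ge>t. \<exists>s'. R (r t') s') \<longrightarrow> (\<exists>t'\<ge>t. R (r t') (r (Suc t'))))"

text \<open>Runs of the asynchronous system: messages between correct replicas arrive eventually, and
  correct replicas eventually perform the steps that stay enabled, both after arbitrary delays.
  Broadcasting is an input and never forced.\<close>

definition mbcl_run :: "('b, 'h) mbcl \<Rightarrow> replica set \<Rightarrow> (nat \<Rightarrow> ('b, 'h) state) \<Rightarrow> bool" where
  "mbcl_run P F r \<longleftrightarrow>
     r 0 = initial_state \<and>
     (\<forall>t. system_step P F (r t) (r (Suc t))) \<and>
     (\<forall>p\<in>correct P F. \<forall>q\<in>correct P F. \<forall>M t.
        (p, q, M) \<in> sent (r t) \<longrightarrow> (\<exists>t'. (p, M) \<in> received (r t') q)) \<and>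
     (\<forall>p\<in>correct P F.
        (\<forall>h b l A. weakly_fair (witness_step P p h b l A) r) \<and>
        (\<forall>h A. weakly_fair (interpolate_step P p h A) r) \<and>
        (\<forall>h A. weakly_fair (ready_step P p h A) r) \<and>
        (\<forall>h. weakly_fair (learn_step P p h) r))"


section \<open>Collision resistance\<close>

fun branch_block :: "('b, 'h) message \<Rightarrow> 'h list \<times> 'b" where
  "branch_block (Init h b l A) = (b, l)"
| "branch_block (Witness h b l A) = (b, l)"
| "branch_block (Ready h b l) = (b, l)"

text \<open>Inputs hashed by correct replicas in a run: for the tree of a broadcast message, for a
  successful interpolation, and for checking the branch of a received message at some position.\<close>

definition hash_inputs ::
  "('b, 'h) mbcl \<Rightarrow> replica set \<Rightarrow> (nat \<Rightarrow> ('b, 'h) state) \<Rightarrow> ('b, 'h) hash_input set" where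
  "hash_inputs P F r =
     (\<Union>p\<in>correct P F. \<Union>t.
        (\<Union>m\<in>broadcasts (r t) p. tree_inputs (hash P) (encode P m)) \<union>
        (\<Union>ls\<in>{ls. \<exists>h A. phase (r t) p h A = Interpolated ls}. tree_inputs (hash P) ls) \<union>
        (\<Union>(q, M)\<in>received (r t) p. \<Union>j<num_active P.
           case branch_block M of (b, l) \<Rightarrow> branch_inputs (hash P) (num_active P) j b l))"

text \<open>Collision resistance cannot be phrased as injectivity of a hash function with outputs of
  bounded length. It is used in the form that no collision turns up among the inputs hashed in
  the run; an injective hash function satisfies this trivially.\<close>

definition no_hash_collision ::
  "('b, 'h) mbcl \<Rightarrow> replica set \<Rightarrow> (nat \<Rightarrow> ('b, 'h) state) \<Rightarrow> bool" where
  "no_hash_collision P F r \<longleftrightarrow> inj_on (hash P) (hash_inputs P F r)"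

end

theory Submission
  imports Defs
begin

text \<open>
  By collision resistance a Merkle root \<open>h\<close> that a correct replica computed from all blocks of some
  \<open>encode P m\<close> determines \<open>m\<close>, and any block with a valid branch for \<open>h\<close> that a correct replica
  receives is the block of \<open>encode P m\<close> at that position. Hence no correct replica aborts for
  \<open>h\<close>, and all of them decode \<open>m\<close>. Every delivery goes back to a correct active replica that
  collected \<open>n\<^sub>1 - f = 4f + 1\<close> witnesses; at least \<open>n\<^sub>1 - 2f = 3f + 1\<close> of them come from correct replicas,
  which sent them to all active replicas. So all correct active replicas interpolate, send their own
  witness, collect \<open>n\<^sub>1 - f\<close> witnesses, deliver, and send enough \<open>Ready\<close> messages for every learner
  to deliver. With a correct sender the first correct witness for \<open>h\<close> answers an \<open>Init\<close> message,
  so \<open>m\<close> was broadcast.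
\<close>

section \<open>Merkle trees\<close>

text \<open>Follows the recursion of \<open>merkle_root\<close>: a list of at least two blocks is
  cut at half its length, and both halves are nonempty and shorter.\<close>

lemma halving_induct [consumes 1, case_names single split]:
  assumes "ls \<noteq> []"
    and "\<And>l. Q [l]"
    and "\<And>ls. 2 \<le> length ls \<Longrightarrow> Q (take (length ls div 2) ls) \<Longrightarrow> Q (drop (length ls div 2) ls) \<Longrightarrow> Q ls"
  shows "Q ls"
  using assms(1)
proof (induction ls rule: length_induct)
  case (1 ls)
  show ?case
  proof (cases "length ls = 1")
    case True
    then show ?thesis using assms(2) by (auto simp: length_Suc_conv)
  next
    case False
    with 1(2) have len: "2 \<le> length ls" by (cases ls) (auto simp: Suc_le_eq)
    have "Q (take (length ls div 2) ls)" "Q (drop (length ls div 2) ls)"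
      using len by (auto intro!: 1(1)[rule_format])
    then show ?thesis by (rule assms(3)[OF len])
  qed
qed

lemma merkle_root_split:
  "2 \<le> length ls \<Longrightarrow> merkle_root H ls =
     H (Node (merkle_root H (take (length ls div 2) ls)) (merkle_root H (drop (length ls div 2) ls)))"
  by (cases "(H, ls)" rule: merkle_root.cases) (auto simp: Let_def)

lemma merkle_branch_split:
  "2 \<le> length ls \<Longrightarrow> merkle_branch H ls j =
     (if j < length ls div 2
      then merkle_root H (drop (length ls div 2) ls) # merkle_branch H (take (length ls div 2) ls) j
      else merkle_root H (take (length ls div 2) ls)
        # merkle_branch H (drop (length ls div 2) ls) (j - length ls div 2))"
  by (cases "(H, ls)" rule: merkle_root.cases) (auto simp: Let_def)

lemma tree_inputs_split:
  "2 \<le> length ls \<Longrightarrow> tree_inputs H ls =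
     insert (Node (merkle_root H (take (length ls div 2) ls)) (merkle_root H (drop (length ls div 2) ls)))
       (tree_inputs H (take (length ls div 2) ls) \<union> tree_inputs H (drop (length ls div 2) ls))"
  by (cases "(H, ls)" rule: merkle_root.cases) (auto simp: Let_def)

section \<open>Completeness and soundness of Merkle branches\<close>

lemma branch_root_merkle_branch:
  assumes "ls \<noteq> []" "j < length ls"
  shows "branch_root H (length ls) j (merkle_branch H ls j) (ls ! j) = Some (merkle_root H ls)"
  using assms
proof (induction ls arbitrary: j rule: halving_induct)
  case (single l)
  then show ?case by simp
next
  case (split ls)
  let ?c = "length ls div 2"
  have c: "1 \<le> ?c" "?c < length ls" using split(1) by auto
  show ?case
  proof (cases "j < ?c")
    case True
    then have "branch_root H ?c j (merkle_branch H (take ?c ls) j) (ls ! j)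
        = Some (merkle_root H (take ?c ls))"
      using split(2)[of j] c by (simp add: min_def)
    then show ?thesis
      using True split(1) c by (simp add: merkle_branch_split[of ls] merkle_root_split[of ls])
  next
    case False
    then have "branch_root H (length ls - ?c) (j - ?c) (merkle_branch H (drop ?c ls) (j - ?c)) (ls ! j)
        = Some (merkle_root H (drop ?c ls))"
      using split(3)[of "j - ?c"] split(4) c by simp
    then show ?thesis
      using False split(1) c by (simp add: merkle_branch_split[of ls] merkle_root_split[of ls])
  qed
qed

lemma valid_merkle_branch:
  "j < length ls \<Longrightarrow> valid_branch H (length ls) (merkle_root H ls) j (merkle_branch H ls j) (ls ! j)"
  unfolding valid_branch_def using branch_root_merkle_branch[of ls j H] by fastforce

text \<open>Descends from the root: equal hashes of two \<open>Node\<close> inputs in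
  \<open>X\<close> force equal children, so the recomputed child is the root of the half containing
  \<open>j\<close>. Collision freedom is asked only on \<open>X\<close>, as
  \<open>no_hash_collision\<close> offers no more.\<close>

lemma branch_root_sound:
  assumes "ls \<noteq> []" "j < length ls" "inj_on H X"
    and "branch_root H (length ls) j b l = Some (merkle_root H ls)"
    and "tree_inputs H ls \<subseteq> X" "branch_inputs H (length ls) j b l \<subseteq> X"
  shows "l = ls ! j"
  using assms
proof (induction ls arbitrary: j b rule: halving_induct)
  case (single l')
  then have "H (Leaf l) = H (Leaf l')" "Leaf l \<in> X" "Leaf l' \<in> X" by (cases b; simp)+
  from inj_onD[OF single(2) this] show ?case using single(1) by simp
next
  case (split ls)
  let ?c = "length ls div 2"
  have c: "1 \<le> ?c" "?c < length ls" "length ls \<noteq> 1" using split(1) by auto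
  have tree: "Node (merkle_root H (take ?c ls)) (merkle_root H (drop ?c ls)) \<in> X"
    "tree_inputs H (take ?c ls) \<subseteq> X" "tree_inputs H (drop ?c ls) \<subseteq> X"
    using split(7) by (auto simp: tree_inputs_split[OF split(1)])
  \<comment> \<open>The empty branch is accepted only in a tree with a single leaf.\<close>
  obtain x xs where b: "b = x # xs" using split(6) c by (cases b) auto
  show ?case
  proof (cases "j < ?c")
    case True
    obtain y where y: "branch_root H ?c j xs l = Some y"
      and eq: "H (Node y x) = H (Node (merkle_root H (take ?c ls)) (merkle_root H (drop ?c ls)))"
      using split(1,6) True c by (auto simp: b merkle_root_split[OF split(1)])
    have X: "Node y x \<in> X" "branch_inputs H ?c j xs l \<subseteq> X"
      using split(8) True c y by (auto simp: b)
    have "y = merkle_root H (take ?c ls)"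
      using inj_onD[OF split(5) eq X(1) tree(1)] by simp
    then show ?thesis
      using split(2)[of j xs] split(5) True c y X tree by (simp add: min_def)
  next
    case False
    obtain y where y: "branch_root H (length ls - ?c) (j - ?c) xs l = Some y"
      and eq: "H (Node x y) = H (Node (merkle_root H (take ?c ls)) (merkle_root H (drop ?c ls)))"
      using split(1,6) False c by (auto simp: b merkle_root_split[OF split(1)])
    have X: "Node x y \<in> X" "branch_inputs H (length ls - ?c) (j - ?c) xs l \<subseteq> X"
      using split(8) False c y by (auto simp: b)
    have "y = merkle_root H (drop ?c ls)"
      using inj_onD[OF split(5) eq X(1) tree(1)] by simp
    then show ?thesis
      using split(3)[of "j - ?c" xs] split(4,5) False c y X tree by simp
  qed
qed

lemma valid_branch_sound:
  assumes "valid_branch H (length ls) (merkle_root H ls) j b l" "inj_on H X"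
    and "tree_inputs H ls \<subseteq> X" "branch_inputs H (length ls) j b l \<subseteq> X"
  shows "l = ls ! j"
  using assms branch_root_sound[of ls j H X b l] unfolding valid_branch_def by force

text \<open>Lists of equal length are cut at the same place, so both trees have the same shape and
  can be compared node by node.\<close>

lemma merkle_root_inject:
  assumes "ls \<noteq> []" "length ls' = length ls" "inj_on H X"
    and "merkle_root H ls' = merkle_root H ls"
    and "tree_inputs H ls \<subseteq> X" "tree_inputs H ls' \<subseteq> X"
  shows "ls' = ls"
  using assms
proof (induction ls arbitrary: ls' rule: halving_induct)
  case (single l)
  then show ?case by (auto simp: length_Suc_conv dest: inj_onD)
next
  case (split ls)
  let ?c = "length ls div 2"
  have len: "2 \<le> length ls'" "length ls' div 2 = ?c" using split(1,4) by auto
  note root = merkle_root_split[of ls' H, unfolded len(2), OF len(1)] merkle_root_split[OF split(1), of H]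
  note inputs = tree_inputs_split[of ls' H, unfolded len(2), OF len(1)] tree_inputs_split[OF split(1), of H]
  have X: "Node (merkle_root H (take ?c ls)) (merkle_root H (drop ?c ls)) \<in> X"
    "Node (merkle_root H (take ?c ls')) (merkle_root H (drop ?c ls')) \<in> X"
    "tree_inputs H (take ?c ls) \<subseteq> X" "tree_inputs H (drop ?c ls) \<subseteq> X"
    "tree_inputs H (take ?c ls') \<subseteq> X" "tree_inputs H (drop ?c ls') \<subseteq> X"
    using split(7,8) unfolding inputs by blast+
  have "H (Node (merkle_root H (take ?c ls')) (merkle_root H (drop ?c ls')))
      = H (Node (merkle_root H (take ?c ls)) (merkle_root H (drop ?c ls)))"
    using split(6) unfolding root .
  from inj_onD[OF split(5) this X(2,1)] have "take ?c ls' = take ?c ls" "drop ?c ls' = drop ?c ls"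
    using split(2)[of "take ?c ls'"] split(3)[of "drop ?c ls'"] split(4,5) X by simp_all
  then show ?case by (metis append_take_drop_id)
qed


section \<open>Positions and collected blocks\<close>

lemma position_less:
  assumes "finite A" "p \<in> A"
  shows "position A p < card A"
  unfolding position_def using assms by (intro psubset_card_mono) auto

lemma position_strict_mono:
  assumes "finite A" "p \<in> A" "p < q"
  shows "position A p < position A q"
  unfolding position_def using assms by (intro psubset_card_mono) auto

lemma inj_on_position: "finite A \<Longrightarrow> inj_on (position A) A"
  by (rule inj_onI) (metis linorder_neqE_nat nat_less_le position_strict_mono)

text \<open>\<open>position A\<close> is injective on \<open>A\<close>, so distinct senders fill
  distinct positions.\<close>

lemma collected_dom:
  assumes "collected P R h A c B" "finite A" "card A = num_active P"
  shows "dom B \<subseteq> {..<num_active P}" "card (dom B) = c"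
proof -
  obtain Q where Q: "Q \<subseteq> A" "card Q = c" "dom B = position A ` Q"
    using assms(1) unfolding collected_def by blast
  show "dom B \<subseteq> {..<num_active P}" using Q assms position_less[of A] by auto
  show "card (dom B) = c"
    using Q inj_on_position[OF assms(2)] by (metis card_image inj_on_subset)
qed

text \<open>\<open>collected\<close> asks for exactly \<open>c\<close> senders, so a larger set
  \<open>Q\<close> is first cut down to \<open>S\<close>.\<close>

lemma collected_ex:
  assumes "finite A" "Q \<subseteq> A" "c \<le> card Q"
    and "\<And>q. q \<in> Q \<Longrightarrow>
      \<exists>b l. R q b l \<and> valid_branch (hash P) (num_active P) h (position A q) b l"
  shows "\<exists>B. collected P R h A c B"
proof -
  obtain S where S: "S \<subseteq> Q" "card S = c" using obtain_subset_with_card_n[OF assms(3)] by metis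
  obtain L where L: "\<And>q. q \<in> Q \<Longrightarrow>
      \<exists>b. R q b (L q) \<and> valid_branch (hash P) (num_active P) h (position A q) b (L q)"
    using assms(4) by metis
  have inj: "inj_on (position A) S"
    using inj_on_position[OF assms(1)] S assms(2) by (meson inj_on_subset subset_trans)
  \<comment> \<open>The inverse of the numbering on \<open>S\<close> finds the sender to which
    position \<open>i\<close> belongs.\<close>
  let ?B = "(\<lambda>i. Some (L (inv_into S (position A) i))) |` (position A ` S)"
  have "\<exists>b l. R q b l \<and> valid_branch (hash P) (num_active P) h (position A q) b l \<and>
      ?B (position A q) = Some l" if "q \<in> S" for q
    using L[of q] S(1) that inv_into_f_f[OF inj that] by auto
  moreover have "dom ?B = position A ` S" by (auto simp: restrict_map_def dom_def)
  ultimately have "collected P R h A c ?B"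
    unfolding collected_def using S assms(2) by blast
  then show ?thesis by blast
qed


section \<open>Single steps\<close>

lemma multicast_simps [simp]:
  "sent (multicast p Q M s) = sent s \<union> (\<lambda>q. (p, q, M q)) ` Q"
  "received (multicast p Q M s) = received s"
  "phase (multicast p Q M s) = phase s"
  "delivered_roots (multicast p Q M s) = delivered_roots s"
  "broadcasts (multicast p Q M s) = broadcasts s"
  "delivered (multicast p Q M s) = delivered s"
  by (simp_all add: multicast_def)

lemma set_phase_simps [simp]:
  "sent (set_phase p h A x s) = sent s"
  "received (set_phase p h A x s) = received s"
  "phase (set_phase p h A x s) p' h' A' = (if p' = p \<and> h' = h \<and> A' = A then x else phase s p' h' A')"
  "delivered_roots (set_phase p h A x s) = delivered_roots s"
  "broadcasts (set_phase p h A x s) = broadcasts s"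
  "delivered (set_phase p h A x s) = delivered s"
  by (simp_all add: set_phase_def)

lemma deliver_simps [simp]:
  "sent (deliver p h m s) = sent s"
  "received (deliver p h m s) = received s"
  "phase (deliver p h m s) = phase s"
  "delivered_roots (deliver p h m s) q =
     (if q = p then insert h (delivered_roots s q) else delivered_roots s q)"
  "broadcasts (deliver p h m s) = broadcasts s"
  "delivered (deliver p h m s) q =
     (if q = p \<and> h \<notin> delivered_roots s p then delivered s q @ [m] else delivered s q)"
  by (auto simp: deliver_def)

lemma system_step_cases [consumes 1, case_names broadcast witness interpolate ready learn byzantine receive skip]:
  assumes "system_step P F s s'"
  obtains p m A where "p \<in> correct P F" "broadcast_step P p m A s s'"
  | p h b l A where "p \<in> correct P F" "witness_step P p h b l A s s'"
  | p h A where "p \<in> correct P F" "interpolate_step P p h A s s'"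
  | p h A where "p \<in> correct P F" "ready_step P p h A s s'"
  | p h where "p \<in> correct P F" "learn_step P p h s s'"
  | p where "p \<in> F" "byzantine_step p s s'"
  | p q M where "receive_step p q M s s'"
  | "s' = s"
  using assms unfolding system_step_def protocol_step_def by blast

lemmas step_defs = broadcast_step_def witness_step_def interpolate_step_def ready_step_def
  learn_step_def byzantine_step_def receive_step_def Let_def

lemma system_step_mono:
  assumes "system_step P F s s'"
  shows "sent s \<subseteq> sent s'" "received s p \<subseteq> received s' p"
    "delivered_roots s p \<subseteq> delivered_roots s' p" "broadcasts s p \<subseteq> broadcasts s' p"
    "set (delivered s p) \<subseteq> set (delivered s' p)"
  using assms by (cases rule: system_step_cases; force simp: step_defs split: if_splits)+

section \<open>Which step causes which change of the state\<close>

lemma received_change: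
  assumes "system_step P F s s'" "(q, M) \<in> received s' p"
  shows "(q, M) \<in> received s p \<or> (q, p, M) \<in> sent s"
  using assms by (cases rule: system_step_cases) (auto simp: step_defs split: if_splits)

lemma phase_change:
  assumes "system_step P F s s'" "phase s' p h A \<noteq> phase s p h A"
  shows "p \<in> correct P F \<and> (interpolate_step P p h A s s' \<or> ready_step P p h A s s')"
  using assms(1)
proof (cases rule: system_step_cases)
  case (interpolate q h' A')
  then have "q = p \<and> h' = h \<and> A' = A"
    using assms(2) by (auto simp: step_defs split: if_splits)
  then show ?thesis using interpolate by auto
next
  case (ready q h' A')
  then have "q = p \<and> h' = h \<and> A' = A"
    using assms(2) by (auto simp: step_defs split: if_splits)
  then show ?thesis using ready by auto
qed (use assms(2) in \<open>auto simp: step_defs split: if_splits\<close>)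

lemma delivered_roots_change:
  assumes "system_step P F s s'" "delivered_roots s' p \<noteq> delivered_roots s p \<or> delivered s' p \<noteq> delivered s p"
  shows "\<exists>h. p \<in> correct P F \<and> h \<notin> delivered_roots s p \<and>
    (learn_step P p h s s' \<or> (\<exists>A. ready_step P p h A s s'))"
  using assms(1)
proof (cases rule: system_step_cases)
  case (ready q h' A')
  then have "q = p \<and> h' \<notin> delivered_roots s p"
    using assms(2) by (auto simp: step_defs split: if_splits)
  then show ?thesis using ready by auto
next
  case (learn q h')
  then have "q = p \<and> h' \<notin> delivered_roots s p"
    using assms(2) by (auto simp: step_defs split: if_splits)
  then show ?thesis using learn by auto
qed (use assms(2) in \<open>auto simp: step_defs split: if_splits\<close>)

lemma broadcasts_change:
  assumes "system_step P F s s'" "m \<in> broadcasts s' p" "m \<notin> broadcasts s p"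
  shows "\<exists>A. broadcast_step P p m A s s'"
  using assms(1)
proof (cases rule: system_step_cases)
  case (broadcast q m' A)
  then have "q = p \<and> m' = m"
    using assms(2,3) by (auto simp: step_defs split: if_splits)
  then show ?thesis using broadcast by auto
qed (use assms(2,3) in \<open>auto simp: step_defs split: if_splits\<close>)

text \<open>A faulty replica sends only under its own name, so a new message of a correct
  \<open>p\<close> comes from a protocol step of \<open>p\<close>.\<close>

lemma init_sent_change:
  assumes "system_step P F s s'" "(p, x, Init h b l A) \<in> sent s'" "(p, x, Init h b l A) \<notin> sent s"
    "p \<in> correct P F"
  shows "\<exists>m. broadcast_step P p m A s s' \<and> h = merkle_root (hash P) (encode P m)"
  using assms(1)
proof (cases rule: system_step_cases)
  case (broadcast q m A')
  then have "q = p \<and> A' = A \<and> h = merkle_root (hash P) (encode P m)"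
    using assms(2,3) by (auto simp: step_defs split: if_splits)
  then show ?thesis using broadcast by auto
qed (use assms(2-4) in \<open>auto simp: step_defs correct_def split: if_splits\<close>)

text \<open>An aborting interpolation sends nothing, so a new witness from
  \<open>interpolate_step\<close> certifies a successful one.\<close>

lemma witness_sent_change:
  assumes "system_step P F s s'" "(p, x, Witness h b l A) \<in> sent s'"
    "(p, x, Witness h b l A) \<notin> sent s" "p \<in> correct P F"
  shows "witness_step P p h b l A s s' \<or>
    interpolate_step P p h A s s' \<and> (\<forall>y\<in>A. (p, y, Witness h b l A) \<in> sent s')
      \<and> (\<exists>ls. phase s' p h A = Interpolated ls)"
  using assms(1)
proof (cases rule: system_step_cases)
  case (witness q h' b' l' A')
  then have "q = p \<and> A' = A \<and> h' = h \<and> b' = b \<and> l' = l"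
    using assms(2,3) by (auto simp: step_defs split: if_splits)
  then show ?thesis using witness by auto
next
  case (interpolate q h' A')
  then have "q = p \<and> A' = A \<and> h' = h \<and> (\<forall>y\<in>A. (p, y, Witness h b l A) \<in> sent s')
      \<and> (\<exists>ls. phase s' p h A = Interpolated ls)"
    using assms(2,3) by (auto simp: step_defs split: if_splits)
  then show ?thesis using interpolate by auto
qed (use assms(2-4) in \<open>auto simp: step_defs correct_def split: if_splits\<close>)

lemma ready_sent_change:
  assumes "system_step P F s s'" "(p, x, Ready h b l) \<in> sent s'"
    "(p, x, Ready h b l) \<notin> sent s" "p \<in> correct P F"
  shows "\<exists>A. ready_step P p h A s s'"
  using assms(1)
proof (cases rule: system_step_cases)
  case (ready q h' A')
  then have "q = p \<and> h' = h"
    using assms(2,3) by (auto simp: step_defs split: if_splits)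
  then show ?thesis using ready by auto
qed (use assms(2-4) in \<open>auto simp: step_defs correct_def split: if_splits\<close>)


section \<open>Executions\<close>

text \<open>The counting behind all quorum arguments: \<open>4f+1\<close> senders include
  \<open>3f+1\<close> correct ones.\<close>

lemma card_le_card_Diff_add:
  assumes "finite F" "card F \<le> f"
  shows "card Q \<le> card (Q - F) + f"
  using diff_card_le_card_Diff[OF assms(1), of Q] assms(2) by linarith

lemma count_list_le_1: "distinct xs \<Longrightarrow> count_list xs x \<le> 1"
  by (induction xs) auto

text \<open>Finitely many events that persist once they occur hold together from the maximum of
  their times on.\<close>

lemma finite_eventually_ball:
  fixes R :: "'a \<Rightarrow> nat \<Rightarrow> bool"
  assumes "finite Q" "\<And>q. q \<in> Q \<Longrightarrow> \<exists>t. R q t" "\<And>q t t'. R q t \<Longrightarrow> t \<le> t' \<Longrightarrow> R q t'"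
  shows "\<exists>t. \<forall>q\<in>Q. R q t"
  using assms(1,2)
proof (induction Q)
  case (insert x Q)
  then obtain t t' where "\<forall>q\<in>Q. R q t" "R x t'" by (metis insert_iff)
  then have "\<forall>q\<in>insert x Q. R q (max t t')" using assms(3) by (metis insert_iff max.cobounded1 max.cobounded2)
  then show ?case by blast
qed simp

locale mbcl_execution =
  fixes P :: "('b, 'h) mbcl" and f :: nat and F :: "replica set"
    and r :: "nat \<Rightarrow> ('b, 'h) state"
  assumes max_faulty: "max_faulty P = f"
    and num_replicas: "num_replicas P = 7 * f + 1"
    and num_active: "num_active P = 5 * f + 1"
    and sender_replica: "sender P \<in> replicas P"
    and code: "mds_code (num_active P - 2 * f) (num_active P) (encode P) (decode P)"
    and faulty_replicas: "F \<subseteq> replicas P"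
    and card_faulty: "card F \<le> f"
    and run: "mbcl_run P F r"
    and no_collision: "no_hash_collision P F r"
begin

abbreviation (input) root :: "'b list \<Rightarrow> 'h" where
  "root m \<equiv> merkle_root (hash P) (encode P m)"

abbreviation (input) block_branch :: "'b list \<Rightarrow> nat \<Rightarrow> 'h list" where
  "block_branch m j \<equiv> merkle_branch (hash P) (encode P m) j"

section \<open>Parameters, code and run assumptions in usable form\<close>

lemma threshold: "threshold P = 3 * f + 1"
  and quorum: "quorum P = 4 * f + 1"
  by (simp_all add: threshold_def quorum_def max_faulty num_active)

lemma finite_replicas: "finite (replicas P)"
  by (simp add: replicas_def)

lemma finite_faulty: "finite F"
  using faulty_replicas finite_replicas by (rule finite_subset)

lemma active_setD:
  assumes "active_set P A"
  shows "finite A" "A \<subseteq> replicas P" "card A = num_active P"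
  using assms finite_subset[OF _ finite_replicas] by (auto simp: active_set_def)

lemma position_less_num_active: "active_set P A \<Longrightarrow> p \<in> A \<Longrightarrow> position A p < num_active P"
  using active_setD position_less by metis

lemma length_encode: "length m = threshold P \<Longrightarrow> length (encode P m) = num_active P"
  using code unfolding mds_code_def threshold_def max_faulty by blast

lemma decode_encode:
  assumes "length m = threshold P" "J \<subseteq> {..<num_active P}" "card J = threshold P"
  shows "decode P ((\<lambda>j. Some (encode P m ! j)) |` J) = m"
  using assms code unfolding mds_code_def threshold_def max_faulty by blast

lemma length_decode:
  assumes "dom B \<subseteq> {..<num_active P}" "card (dom B) = threshold P"
  shows "length (decode P B) = threshold P"
  using assms code unfolding mds_code_def threshold_def max_faulty by blast

text \<open>Decoding the common codeword from its first \<open>3f+1\<close> positions returns both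
  messages.\<close>

lemma encode_inject:
  assumes "length m = threshold P" "length m' = threshold P" "encode P m' = encode P m"
  shows "m' = m"
  using decode_encode[of m "{..<threshold P}"] decode_encode[of m' "{..<threshold P}"] assms
  by (simp add: threshold num_active)

lemma run_step: "system_step P F (r t) (r (Suc t))"
  and run_start: "r 0 = initial_state"
  using run by (simp_all add: mbcl_run_def)

lemma arrival:
  assumes "p \<in> correct P F" "q \<in> correct P F" "(p, q, M) \<in> sent (r t)"
  shows "\<exists>t'. (p, M) \<in> received (r t') q"
  using run assms unfolding mbcl_run_def by blast

lemma fair:
  assumes "p \<in> correct P F"
  shows "weakly_fair (witness_step P p h b l A) r" "weakly_fair (interpolate_step P p h A) r"
    "weakly_fair (ready_step P p h A) r" "weakly_fair (learn_step P p h) r"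
  using run assms unfolding mbcl_run_def by blast+

lemma run_mono:
  assumes "t \<le> t'"
  shows "sent (r t) \<subseteq> sent (r t')" "received (r t) p \<subseteq> received (r t') p"
    "delivered_roots (r t) p \<subseteq> delivered_roots (r t') p" "broadcasts (r t) p \<subseteq> broadcasts (r t') p"
    "set (delivered (r t) p) \<subseteq> set (delivered (r t') p)"
  using lift_Suc_mono_le[of "\<lambda>t. sent (r t)", OF system_step_mono(1)[OF run_step] assms]
    lift_Suc_mono_le[of "\<lambda>t. received (r t) p", OF system_step_mono(2)[OF run_step] assms]
    lift_Suc_mono_le[of "\<lambda>t. delivered_roots (r t) p", OF system_step_mono(3)[OF run_step] assms]
    lift_Suc_mono_le[of "\<lambda>t. broadcasts (r t) p", OF system_step_mono(4)[OF run_step] assms]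
    lift_Suc_mono_le[of "\<lambda>t. set (delivered (r t) p)", OF system_step_mono(5)[OF run_step] assms]
  by simp_all

lemma received_sent: "(q, M) \<in> received (r t) p \<Longrightarrow> (q, p, M) \<in> sent (r t)"
proof (induction t)
  case 0
  then show ?case by (simp add: run_start initial_state_def)
next
  case (Suc t)
  then show ?case using received_change[OF run_step Suc.prems] system_step_mono(1)[OF run_step[of t]] by auto
qed


subsection \<open>Messages determined by their root\<close>

text \<open>The last conjunct holds as soon as some correct replica has computed \<open>h\<close> from all the blocks of
  \<open>m\<close>; it makes collision resistance applicable to this tree.\<close>

definition known :: "'h \<Rightarrow> 'b list \<Rightarrow> bool" where
  "known h m \<longleftrightarrow> length m = threshold P \<and> root m = h \<and>
     tree_inputs (hash P) (encode P m) \<subseteq> hash_inputs P F r"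

text \<open>All codewords have length \<open>n\<^sub>1\<close>, so equal roots give equal codewords,
  hence equal messages.\<close>

lemma known_unique:
  assumes "known h m" "known h m'"
  shows "m' = m"
proof -
  have "encode P m' = encode P m"
    using assms no_collision length_encode[of m] length_encode[of m'] num_active
    unfolding known_def no_hash_collision_def by (intro merkle_root_inject) auto
  then show ?thesis using assms encode_inject unfolding known_def by blast
qed

lemma known_broadcast:
  assumes "p \<in> correct P F" "m \<in> broadcasts (r t) p" "length m = threshold P"
  shows "known (root m) m"
  using assms unfolding known_def hash_inputs_def by blast

text \<open>\<open>hash_inputs\<close> includes the branch check of every received message at every
  position, so soundness of branches also covers blocks from faulty senders.\<close>

lemma known_block:
  assumes "known h m" "p \<in> correct P F" "(q, M) \<in> received (r t) p" "branch_block M = (b, l)"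
    and "valid_branch (hash P) (num_active P) h j b l"
  shows "l = encode P m ! j"
proof -
  have j: "j < num_active P" using assms(5) by (simp add: valid_branch_def)
  have "branch_inputs (hash P) (num_active P) j b l \<subseteq> hash_inputs P F r"
  proof
    fix x assume "x \<in> branch_inputs (hash P) (num_active P) j b l"
    then have "x \<in> (case (q, M) of (q, M) \<Rightarrow>
        \<Union>j<num_active P. case branch_block M of (b, l) \<Rightarrow> branch_inputs (hash P) (num_active P) j b l)"
      using assms(4) j by auto
    then have "x \<in> (\<Union>(q, M)\<in>received (r t) p.
        \<Union>j<num_active P. case branch_block M of (b, l) \<Rightarrow> branch_inputs (hash P) (num_active P) j b l)"
      by (rule UN_I[OF assms(3)])
    then show "x \<in> hash_inputs P F r"
      unfolding hash_inputs_def by (intro UN_I[OF assms(2)] UN_I[of t, OF UNIV_I] UnI2)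
  qed
  moreover have "valid_branch (hash P) (length (encode P m)) (root m) j b l"
    using assms(1,5) length_encode by (simp add: known_def)
  ultimately show ?thesis
    using assms(1) no_collision length_encode[of m] valid_branch_sound
    unfolding known_def no_hash_collision_def by metis
qed

text \<open>The predicate \<open>R\<close> is left abstract so that blocks from
  \<open>Witness\<close> and from \<open>Ready\<close> messages are treated alike.\<close>

lemma known_collected:
  assumes "known h m" "p \<in> correct P F" "active_set P A" "collected P R h A c B"
    and "\<And>q b l. R q b l \<Longrightarrow> \<exists>M. (q, M) \<in> received (r t) p \<and> branch_block M = (b, l)"
  shows "D \<subseteq> dom B \<Longrightarrow> B |` D = (\<lambda>j. Some (encode P m ! j)) |` D"
proof -
  have "B j = Some (encode P m ! j)" if j: "j \<in> dom B" for j
  proof -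
    obtain Q where "dom B = position A ` Q"
      "\<forall>q\<in>Q. \<exists>b l. R q b l \<and> valid_branch (hash P) (num_active P) h (position A q) b l \<and>
         B (position A q) = Some l"
      using assms(4) unfolding collected_def by blast
    moreover from this(1) j obtain q where "q \<in> Q" "j = position A q" by auto
    ultimately obtain b l where "R q b l" "valid_branch (hash P) (num_active P) h j b l" "B j = Some l"
      by blast
    moreover from this(1) obtain M where "(q, M) \<in> received (r t) p" "branch_block M = (b, l)"
      using assms(5) by blast
    ultimately show ?thesis using known_block[OF assms(1,2)] by simp
  qed
  then show "D \<subseteq> dom B \<Longrightarrow> B |` D = (\<lambda>j. Some (encode P m ! j)) |` D"
    by (auto simp: restrict_map_def fun_eq_iff)
qed

lemma known_decode:
  assumes "known h m" "p \<in> correct P F" "active_set P A" "collected P R h A c B"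
    and "\<And>q b l. R q b l \<Longrightarrow> \<exists>M. (q, M) \<in> received (r t) p \<and> branch_block M = (b, l)"
    and "D \<subseteq> dom B" "card D = threshold P"
  shows "decode P (B |` D) = m"
  using known_collected[OF assms(1-6)] decode_encode[of m D] assms(1,6,7)
    collected_dom(1)[OF assms(4)] active_setD[OF assms(3)]
  unfolding known_def by auto

lemma witness_received_block:
  "(q, Witness h b l A) \<in> received s p \<Longrightarrow> \<exists>M. (q, M) \<in> received s p \<and> branch_block M = (b, l)"
  by force

lemma ready_received_block:
  "(q, Ready h b l) \<in> received s p \<Longrightarrow> \<exists>M. (q, M) \<in> received s p \<and> branch_block M = (b, l)"
  by force

lemma known_decode_threshold:
  assumes "known h m" "p \<in> correct P F" "active_set P A" "witness_blocks P (r t) p h A (threshold P) B"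
  shows "decode P B = m"
proof -
  \<comment> \<open>Interpolation decodes all of \<open>B\<close>, which is the case
    \<open>D = dom B\<close> of \<open>known_decode\<close>.\<close>
  have "B |` dom B = B" by (auto simp: restrict_map_def fun_eq_iff domIff)
  moreover have "card (dom B) = threshold P"
    using assms(4) collected_dom(2) active_setD[OF assms(3)] unfolding witness_blocks_def by metis
  ultimately show ?thesis
    using known_decode[OF assms(1-3) assms(4)[unfolded witness_blocks_def] witness_received_block subset_refl]
    by simp
qed

text \<open>For a known root the free choice of blocks in \<open>decoded\<close> does not affect the
  result.\<close>

lemma known_decoded:
  assumes "known h m" "p \<in> correct P F" "active_set P A" "decoded P B m'"
    and "witness_blocks P (r t) p h A c B \<or> ready_blocks P (r t) p h A c B"
  shows "m' = m"
proof -
  obtain D where D: "D \<subseteq> dom B" "card D = threshold P" "m' = decode P (B |` D)"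
    using assms(4) unfolding decoded_def by blast
  from assms(5) have "decode P (B |` D) = m"
  proof
    assume "witness_blocks P (r t) p h A c B"
    from known_decode[OF assms(1-3) this[unfolded witness_blocks_def] witness_received_block D(1,2)]
    show ?thesis .
  next
    assume "ready_blocks P (r t) p h A c B"
    from known_decode[OF assms(1-3) this[unfolded ready_blocks_def] ready_received_block D(1,2)]
    show ?thesis .
  qed
  then show ?thesis using D(3) by simp
qed


subsection \<open>Safety\<close>

lemma collected_correct:
  assumes "collected P R h A c B" "f < c"
  obtains q b l where "q \<in> A" "q \<notin> F" "R q b l"
proof -
  obtain Q where Q: "Q \<subseteq> A" "card Q = c" "\<forall>q\<in>Q. \<exists>b l. R q b l \<and>
      valid_branch (hash P) (num_active P) h (position A q) b l \<and> B (position A q) = Some l"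
    using assms(1) unfolding collected_def by blast
  have "0 < card (Q - F)"
    using card_le_card_Diff_add[OF finite_faulty card_faulty, of Q] Q(2) assms(2) by linarith
  then obtain q where "q \<in> Q - F" by (auto simp: card_gt_0_iff)
  then show thesis using Q that by blast
qed

lemma correct_activeI: "active_set P A \<Longrightarrow> q \<in> A \<Longrightarrow> q \<notin> F \<Longrightarrow> q \<in> correct P F"
  using active_setD by (auto simp: correct_def)

section \<open>Origin of messages and phases\<close>

lemma init_sent:
  assumes "(p, x, Init h b l A) \<in> sent (r t)" "p \<in> correct P F"
  shows "p = sender P \<and> (\<exists>m\<in>broadcasts (r t) p. length m = threshold P \<and> root m = h)"
  using assms(1)
proof (induction t)
  case 0
  then show ?case by (simp add: run_start initial_state_def)
next
  case (Suc t)
  show ?case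
  proof (cases "(p, x, Init h b l A) \<in> sent (r t)")
    case True
    from Suc.IH[OF this] show ?thesis
      using system_step_mono(4)[OF run_step[of t], where p = p] by blast
  next
    case False
    from init_sent_change[OF run_step Suc.prems False assms(2)]
    show ?thesis by (auto simp: broadcast_step_def Let_def)
  qed
qed

lemma broadcast_init:
  assumes "m \<in> broadcasts (r t) p"
  shows "p = sender P \<and> length m = threshold P \<and> (\<exists>A. active_set P A \<and>
    (\<forall>q\<in>A. (p, q, Init (root m) (block_branch m (position A q)) (encode P m ! position A q) A)
      \<in> sent (r t)))"
  using assms
proof (induction t)
  case 0
  then show ?case by (simp add: run_start initial_state_def)
next
  case (Suc t)
  show ?case
  proof (cases "m \<in> broadcasts (r t) p")
    case True
    from Suc.IH[OF this] show ?thesis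
      using system_step_mono(1)[OF run_step[of t]] by blast
  next
    case False
    from broadcasts_change[OF run_step Suc.prems False]
    show ?thesis by (auto simp: broadcast_step_def Let_def)
  qed
qed

text \<open>The first conjunct lets every correct active replica eventually count what one of them
  counted. The second gives the cause; an earlier \<open>t'\<close> is allowed because the phase may
  have become \<open>Completed\<close> since.\<close>

lemma witness_sent:
  assumes "(p, x, Witness h b l A) \<in> sent (r t)" "p \<in> correct P F"
  shows "(\<forall>y\<in>A. (p, y, Witness h b l A) \<in> sent (r t)) \<and>
    ((sender P, Init h b l A) \<in> received (r t) p \<or> (\<exists>t'\<le>t. \<exists>ls. phase (r t') p h A = Interpolated ls))"
  using assms(1)
proof (induction t)
  case 0
  then show ?case by (simp add: run_start initial_state_def)
next
  case (Suc t)
  show ?case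
  proof (cases "(p, x, Witness h b l A) \<in> sent (r t)")
    case True
    then show ?thesis
      using Suc.IH[OF True] system_step_mono(1)[OF run_step[of t]]
        system_step_mono(2)[OF run_step[of t], where p = p] le_SucI[of _ t] by blast
  next
    case False
    from witness_sent_change[OF run_step Suc.prems False assms(2)] show ?thesis
      using system_step_mono(2)[OF run_step[of t]] by (auto simp: witness_step_def)
  qed
qed

text \<open>\<open>Ready\<close> carries no active set, so the set used by \<open>p\<close> is only
  known to exist.\<close>

lemma ready_sent:
  assumes "(p, x, Ready h b l) \<in> sent (r t)" "p \<in> correct P F"
  shows "\<exists>t'<t. \<exists>A. ready_step P p h A (r t') (r (Suc t'))"
  using assms(1)
proof (induction t)
  case 0
  then show ?case by (simp add: run_start initial_state_def)
next
  case (Suc t)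
  show ?case
  proof (cases "(p, x, Ready h b l) \<in> sent (r t)")
    case True
    then show ?thesis using Suc.IH less_SucI by blast
  next
    case False
    from ready_sent_change[OF run_step Suc.prems this assms(2)] show ?thesis by blast
  qed
qed

text \<open>Successful interpolation recomputes \<open>h\<close> from all blocks and so makes it
  known, even if the sender is faulty.\<close>

lemma interpolatedD:
  assumes "phase (r t) p h A = Interpolated ls"
  shows "p \<in> correct P F \<and> p \<in> A \<and> active_set P A \<and>
    (\<exists>t'<t. \<exists>B. witness_blocks P (r t') p h A (threshold P) B) \<and>
    (\<exists>m. ls = encode P m \<and> known h m \<and>
      (\<forall>q\<in>A. (p, q, Witness h (block_branch m (position A p)) (encode P m ! position A p) A) \<in> sent (r t)))"
  using assms
proof (induction t)
  case 0
  then show ?case by (simp add: run_start initial_state_def)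
next
  case (Suc t)
  show ?case
  proof (cases "phase (r t) p h A = Interpolated ls")
    case True
    from Suc.IH[OF this] show ?thesis
      using system_step_mono(1)[OF run_step[of t]] less_SucI[of _ t] by blast
  next
    case False
    with Suc.prems have "phase (r (Suc t)) p h A \<noteq> phase (r t) p h A" by simp
    \<comment> \<open>A ready step would have left the phase \<open>Completed\<close>.\<close>
    from phase_change[OF run_step this] Suc.prems have p: "p \<in> correct P F"
      and "interpolate_step P p h A (r t) (r (Suc t))"
      by (auto simp: ready_step_def Let_def)
    from this(2) obtain B where A: "active_set P A" "p \<in> A"
      and B: "witness_blocks P (r t) p h A (threshold P) B"
      and "let ls = encode P (decode P B); i = position A p
         in if merkle_root (hash P) ls = h
            then r (Suc t) = multicast p A (\<lambda>_. Witness h (merkle_branch (hash P) ls i) (ls ! i) A)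
                        (set_phase p h A (Interpolated ls) (r t))
            else r (Suc t) = set_phase p h A Aborted (r t)"
      unfolding interpolate_step_def by blast
    then have ls: "ls = encode P (decode P B)" "merkle_root (hash P) ls = h"
      and snt: "\<forall>q\<in>A. (p, q, Witness h (merkle_branch (hash P) ls (position A p)) (ls ! position A p) A) \<in> sent (r (Suc t))"
      using Suc.prems by (auto simp: Let_def split: if_splits)
    \<comment> \<open>The blocks in \<open>B\<close> need not belong to a codeword; the last clause
      of \<open>mds_code\<close> covers this case.\<close>
    have "length (decode P B) = threshold P"
      using collected_dom[OF B[unfolded witness_blocks_def] active_setD(1,3)[OF A(1)]]
      by (rule length_decode)
    moreover have "tree_inputs (hash P) ls \<subseteq> hash_inputs P F r"
      using Suc.prems unfolding hash_inputs_def
      by (intro subsetI UN_I[OF p] UN_I[of "Suc t", OF UNIV_I] UnI1 UnI2)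
         (intro UN_I[of ls] CollectI exI)
    ultimately have "known h (decode P B)" using ls by (simp add: known_def)
    then show ?thesis using p A B ls snt by blast
  qed
qed

text \<open>The message decoded from the quorum and the one found by interpolation have the same
  known root, so they coincide.\<close>

lemma ready_stepD:
  assumes "ready_step P p h A (r t) (r (Suc t))"
  obtains m where "phase (r t) p h A = Interpolated (encode P m)" "known h m"
    "r (Suc t) = deliver p h m
       (multicast p (replicas P - A)
         (\<lambda>_. Ready h (block_branch m (position A p)) (encode P m ! position A p))
         (set_phase p h A Completed (r t)))"
    "p \<in> correct P F" "p \<in> A" "active_set P A"
    "\<exists>B. witness_blocks P (r t) p h A (quorum P) B"
proof -
  obtain ls B m' where *: "phase (r t) p h A = Interpolated ls" "witness_blocks P (r t) p h A (quorum P) B"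
    "decoded P B m'" "r (Suc t) = deliver p h m'
       (multicast p (replicas P - A)
         (\<lambda>_. Ready h (merkle_branch (hash P) ls (position A p)) (ls ! position A p))
         (set_phase p h A Completed (r t)))"
    using assms by (auto simp: ready_step_def Let_def)
  from interpolatedD[OF *(1)] obtain m where m: "ls = encode P m" "known h m"
    "p \<in> correct P F" "p \<in> A" "active_set P A" by blast
  have "m' = m" using known_decoded[OF m(2,3,5) *(3)] *(2) by blast
  then show thesis using that m * by blast
qed

text \<open>A learner's quorum contains a correct sender of \<open>Ready\<close>, so its delivery
  also goes back to a ready step of a correct active replica.\<close>

lemma delivery_step:
  assumes "learn_step P p h (r t) (r (Suc t)) \<or> (\<exists>A. ready_step P p h A (r t) (r (Suc t)))"
    and "p \<in> correct P F" "h \<notin> delivered_roots (r t) p"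
  shows "\<exists>m. known h m \<and> delivered (r (Suc t)) p = delivered (r t) p @ [m] \<and>
    delivered_roots (r (Suc t)) p = insert h (delivered_roots (r t) p) \<and>
    (\<exists>q\<in>correct P F. \<exists>t'\<le>t. \<exists>A. ready_step P q h A (r t') (r (Suc t')))"
  using assms(1)
proof
  assume "\<exists>A. ready_step P p h A (r t) (r (Suc t))"
  then obtain A where A: "ready_step P p h A (r t) (r (Suc t))" ..
  from ready_stepD[OF A] obtain m where "known h m" "delivered (r (Suc t)) p = delivered (r t) p @ [m]"
    "delivered_roots (r (Suc t)) p = insert h (delivered_roots (r t) p)"
    using assms(3) by (metis deliver_simps(4,6) multicast_simps(4,6) set_phase_simps(4,6))
  then show ?thesis using A assms(2) by blast
next
  assume "learn_step P p h (r t) (r (Suc t))"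
  then obtain A B m where A: "active_set P A" "ready_blocks P (r t) p h A (quorum P) B" "decoded P B m"
    "r (Suc t) = deliver p h m (r t)"
    by (auto simp: learn_step_def)
  obtain q b l where q: "q \<in> A" "q \<notin> F" "(q, Ready h b l) \<in> received (r t) p"
    by (rule collected_correct[OF A(2)[unfolded ready_blocks_def]]) (simp add: quorum)
  have C: "q \<in> correct P F" using correct_activeI A(1) q by blast
  \<comment> \<open>\<open>A'\<close> may differ from the learner's \<open>A\<close>; only the root
    \<open>h\<close> is needed to identify the message.\<close>
  then obtain t' A' where t': "t' < t" "ready_step P q h A' (r t') (r (Suc t'))"
    using ready_sent[OF received_sent[OF q(3)]] by blast
  obtain m' where "known h m'" using ready_stepD[OF t'(2)] by metis
  moreover from this have "m = m'" using known_decoded[OF _ assms(2) A(1,3)] A(2) by blast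
  moreover have "\<exists>q\<in>correct P F. \<exists>t'\<le>t. \<exists>A. ready_step P q h A (r t') (r (Suc t'))"
    using C t' less_imp_le by blast
  ultimately show ?thesis
    using A(4) assms(3) by (intro exI[of _ m]) auto
qed

text \<open>Delivered messages and delivered roots correspond via \<open>known\<close>, which turns
  at most one delivery per root into at most one per message.\<close>

lemma delivered_roots_known:
  assumes "p \<in> correct P F"
  shows "distinct (delivered (r t) p) \<and>
    (\<forall>m\<in>set (delivered (r t) p). \<exists>h\<in>delivered_roots (r t) p. known h m) \<and>
    (\<forall>h\<in>delivered_roots (r t) p. \<exists>m\<in>set (delivered (r t) p). known h m) \<and>
    (\<forall>h\<in>delivered_roots (r t) p. \<exists>q\<in>correct P F. \<exists>t'<t. \<exists>A. ready_step P q h A (r t') (r (Suc t')))"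
proof (induction t)
  case 0
  then show ?case by (simp add: run_start initial_state_def)
next
  case (Suc t)
  show ?case
  proof (cases "delivered_roots (r (Suc t)) p \<noteq> delivered_roots (r t) p \<or>
      delivered (r (Suc t)) p \<noteq> delivered (r t) p")
    case False
    then show ?thesis using Suc less_SucI by metis
  next
    case True
    from delivered_roots_change[OF run_step True] obtain h where h: "h \<notin> delivered_roots (r t) p"
      and "learn_step P p h (r t) (r (Suc t)) \<or> (\<exists>A. ready_step P p h A (r t) (r (Suc t)))"
      by blast
    from delivery_step[OF this(2) assms h] obtain m q t' A where m: "known h m"
      "delivered (r (Suc t)) p = delivered (r t) p @ [m]"
      "delivered_roots (r (Suc t)) p = insert h (delivered_roots (r t) p)"
      and q: "q \<in> correct P F" "t' < Suc t" "ready_step P q h A (r t') (r (Suc t'))"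
      by (auto simp: less_Suc_eq_le)
    \<comment> \<open>An earlier delivery of \<open>m\<close> would have been for
      \<open>root m = h\<close>, but \<open>h\<close> is new.\<close>
    have "m \<notin> set (delivered (r t) p)"
      using Suc m(1) h unfolding known_def by blast
    moreover have "\<forall>h'\<in>delivered_roots (r t) p.
        \<exists>q\<in>correct P F. \<exists>t'<Suc t. \<exists>A. ready_step P q h' A (r t') (r (Suc t'))"
      using Suc less_SucI by meson
    ultimately show ?thesis
      using Suc m q by auto
  qed
qed

text \<open>Strong induction on time: a witness caused by interpolation rests on more than
  \<open>f\<close> earlier witnesses, one of them from a correct replica, until an
  \<open>Init\<close> of the correct sender is reached.\<close>

lemma witness_sent_broadcast:
  assumes "sender P \<in> correct P F" "p \<in> correct P F" "(p, x, Witness h b l A) \<in> sent (r t)"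
  shows "\<exists>m\<in>broadcasts (r t) (sender P). length m = threshold P \<and> root m = h"
  using assms(2,3)
proof (induction t arbitrary: p x b l rule: less_induct)
  case (less t)
  from witness_sent[OF less.prems(2,1)]
  consider "(sender P, Init h b l A) \<in> received (r t) p"
    | t' ls where "t' \<le> t" "phase (r t') p h A = Interpolated ls" by blast
  then show ?case
  proof cases
    case 1
    then show ?thesis using received_sent init_sent assms(1) by blast
  next
    case 2
    from interpolatedD[OF 2(2)] obtain t'' B where A: "t'' < t'" "active_set P A"
      and B: "witness_blocks P (r t'') p h A (threshold P) B" by blast
    obtain q b' l' where q: "q \<in> A" "q \<notin> F" "(q, Witness h b' l' A) \<in> received (r t'') p"
      by (rule collected_correct[OF B[unfolded witness_blocks_def]]) (simp add: threshold)
    have "\<exists>m\<in>broadcasts (r t'') (sender P). length m = threshold P \<and> root m = h"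
      using less.IH[OF _ correct_activeI[OF A(2) q(1,2)] received_sent[OF q(3)]] A(1) 2(1) by simp
    then show ?thesis using run_mono(4)[of t'' t "sender P"] A(1) 2(1) by fastforce
  qed
qed

lemma integrity: "rb_integrity (correct P F) (sender P) (\<lambda>t. broadcasts (r t)) (\<lambda>t. delivered (r t))"
  unfolding rb_integrity_def
proof (intro ballI allI conjI impI)
  fix p m t assume p: "p \<in> correct P F"
  show "count_list (delivered (r t) p) m \<le> 1"
    using delivered_roots_known[OF p, of t] by (blast intro: count_list_le_1)
next
  fix p m t assume p: "p \<in> correct P F" and *: "sender P \<in> correct P F \<and> m \<in> set (delivered (r t) p)"
  then obtain h q t' A where h: "known h m" "q \<in> correct P F" "t' < t" "ready_step P q h A (r t') (r (Suc t'))"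
    using delivered_roots_known[OF p, of t] by meson
  obtain m' where "phase (r t') q h A = Interpolated (encode P m')" using ready_stepD[OF h(4)] by metis
  \<comment> \<open>\<open>q\<close> sent its own witness when it interpolated, strictly before the
    delivery at \<open>p\<close> is observed.\<close>
  from interpolatedD[OF this] obtain x b l where "(q, x, Witness h b l A) \<in> sent (r t')" by blast
  from witness_sent_broadcast[OF _ h(2) this] * obtain m'' where
    m'': "m'' \<in> broadcasts (r t') (sender P)" "length m'' = threshold P" "root m'' = h" by blast
  then have "known h m''" using known_broadcast * by blast
  then have "m'' = m" using known_unique h(1) by blast
  then show "\<exists>t'<t. m \<in> broadcasts (r t') (sender P)" using m'' h(3) by blast
qed

subsection \<open>Liveness\<close>

lemma known_valid_branch:
  "known h m \<Longrightarrow> j < num_active P \<Longrightarrow>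
    valid_branch (hash P) (num_active P) h j (block_branch m j) (encode P m ! j)"
  using valid_merkle_branch[of j "encode P m" "hash P"] length_encode[of m] by (auto simp: known_def)

text \<open>\<open>M\<close> stands for a \<open>Witness\<close> or \<open>Ready\<close> message
  with fixed root. The claim covers all later times because weak fairness needs steps that stay
  enabled.\<close>

lemma eventually_collected:
  assumes "active_set P A" "p \<in> correct P F" "Q \<subseteq> A - F" "c \<le> card Q"
    and "\<And>q. q \<in> Q \<Longrightarrow> \<exists>b l t. (q, p, M b l) \<in> sent (r t) \<and>
      valid_branch (hash P) (num_active P) h (position A q) b l"
  shows "\<exists>t. \<forall>t'\<ge>t. \<exists>B. collected P (\<lambda>q b l. (q, M b l) \<in> received (r t') p) h A c B"
proof -
  let ?R = "\<lambda>q t. \<exists>b l. (q, M b l) \<in> received (r t) p \<and>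
    valid_branch (hash P) (num_active P) h (position A q) b l"
  have Q: "finite Q" "Q \<subseteq> A" using assms(3) active_setD(1)[OF assms(1)] by (auto intro: finite_subset)
  have "\<exists>t. \<forall>q\<in>Q. ?R q t"
  proof (rule finite_eventually_ball[OF Q(1)])
    fix q assume q: "q \<in> Q"
    then have "q \<in> correct P F" using assms(1,3) correct_activeI by blast
    then show "\<exists>t. ?R q t" using assms(5)[OF q] arrival[OF _ assms(2)] by meson
  next
    fix q t t' assume "?R q t" "t \<le> t'"
    then show "?R q t'" using run_mono(2)[of t t' p] by blast
  qed
  then obtain t where t: "\<forall>q\<in>Q. ?R q t" by blast
  show ?thesis
  proof (rule exI[of _ t], intro allI impI)
    fix t' assume "t \<le> t'"
    then have "?R q t'" if "q \<in> Q" for q using t that run_mono(2)[of t t' p] by blast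
    then show "\<exists>B. collected P (\<lambda>q b l. (q, M b l) \<in> received (r t') p) h A c B"
      using active_setD(1)[OF assms(1)] Q(2) assms(4) by (intro collected_ex) auto
  qed
qed

text \<open>For a known root no correct replica is ever \<open>Aborted\<close>.\<close>

lemma phase_not_waiting:
  assumes "known h m" "phase (r t) p h A \<noteq> Waiting"
  shows "\<exists>t'\<le>t. phase (r t') p h A = Interpolated (encode P m)"
  using assms(2)
proof (induction t)
  case 0
  then show ?case by (simp add: run_start initial_state_def)
next
  case (Suc t)
  show ?case
  proof (cases "phase (r (Suc t)) p h A = phase (r t) p h A")
    case True
    then show ?thesis using Suc le_SucI by metis
  next
    case False
    from phase_change[OF run_step False] have p: "p \<in> correct P F"
      and "interpolate_step P p h A (r t) (r (Suc t)) \<or> ready_step P p h A (r t) (r (Suc t))"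
      by auto
    from this(2) show ?thesis
    proof
      assume *: "interpolate_step P p h A (r t) (r (Suc t))"
      then obtain B where "active_set P A" "witness_blocks P (r t) p h A (threshold P) B"
        and B: "let ls = encode P (decode P B); i = position A p
         in if merkle_root (hash P) ls = h
            then r (Suc t) = multicast p A (\<lambda>_. Witness h (merkle_branch (hash P) ls i) (ls ! i) A)
                        (set_phase p h A (Interpolated ls) (r t))
            else r (Suc t) = set_phase p h A Aborted (r t)"
        unfolding interpolate_step_def by blast
      \<comment> \<open>Hence the recomputed root is \<open>h\<close>, and the aborting branch is
        impossible.\<close>
      then have "decode P B = m" using known_decode_threshold[OF assms(1) p] by blast
      then have "phase (r (Suc t)) p h A = Interpolated (encode P m)"
        using B assms(1) by (simp add: known_def Let_def)
      then show ?thesis by blast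
    next
      assume "ready_step P p h A (r t) (r (Suc t))"
      then obtain m' where "phase (r t) p h A = Interpolated (encode P m')" "known h m'"
        using ready_stepD by metis
      then show ?thesis using known_unique[OF assms(1)] le_SucI[OF order_refl] by metis
    qed
  qed
qed

text \<open>Otherwise the phase would stay \<open>Waiting\<close>, interpolation would stay enabled,
  and fairness would force the step that ends this phase.\<close>

lemma eventually_interpolated:
  assumes "known h m" "p \<in> correct P F" "p \<in> A" "active_set P A"
    and "Q \<subseteq> A - F" "threshold P \<le> card Q"
    and "\<And>q. q \<in> Q \<Longrightarrow> \<exists>b l t. (q, p, Witness h b l A) \<in> sent (r t) \<and>
      valid_branch (hash P) (num_active P) h (position A q) b l"
  shows "\<exists>t. phase (r t) p h A = Interpolated (encode P m)"
proof (rule ccontr)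
  assume "\<nexists>t. phase (r t) p h A = Interpolated (encode P m)"
  then have waiting: "phase (r t) p h A = Waiting" for t
    using phase_not_waiting[OF assms(1)] by blast
  obtain t where t: "\<forall>t'\<ge>t. \<exists>B. witness_blocks P (r t') p h A (threshold P) B"
    using eventually_collected[OF assms(4,2,5,6,7)] unfolding witness_blocks_def by blast
  have "\<exists>s'. interpolate_step P p h A (r t') s'" if "t' \<ge> t" for t'
  proof -
    \<comment> \<open>Enabledness does not depend on the outcome of the root test: both branches
      have a successor.\<close>
    have "\<exists>s. if c then s = x else s = y" for c and x y :: "('b, 'h) state" by (cases c) auto
    then show ?thesis
      using t that waiting assms(3,4) unfolding interpolate_step_def Let_def by blast
  qed
  then obtain t' where "interpolate_step P p h A (r t') (r (Suc t'))"
    using fair(2)[OF assms(2)] unfolding weakly_fair_def by blast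
  then have "phase (r (Suc t')) p h A \<noteq> Waiting"
    by (auto simp: interpolate_step_def Let_def split: if_splits)
  then show False using waiting by simp
qed

text \<open>Only a ready step leaves the phase \<open>Interpolated\<close>, so if none occurred it
  would stay enabled forever.\<close>

lemma eventually_ready_step:
  assumes "phase (r t) p h A = Interpolated ls"
    and "Q \<subseteq> A - F" "quorum P \<le> card Q"
    and "\<And>q. q \<in> Q \<Longrightarrow> \<exists>b l t. (q, p, Witness h b l A) \<in> sent (r t) \<and>
      valid_branch (hash P) (num_active P) h (position A q) b l"
  shows "\<exists>t'. ready_step P p h A (r t') (r (Suc t'))"
proof (rule ccontr)
  assume never: "\<nexists>t'. ready_step P p h A (r t') (r (Suc t'))"
  have p: "p \<in> correct P F" "p \<in> A" "active_set P A" using interpolatedD[OF assms(1)] by auto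
  have ph: "phase (r t') p h A = Interpolated ls" if "t \<le> t'" for t'
    using that
  proof (induction t' rule: dec_induct)
    case base
    then show ?case by (rule assms(1))
  next
    case (step n)
    have "\<not> interpolate_step P p h A (r n) (r (Suc n))"
      using step(3) by (simp add: interpolate_step_def)
    then have "phase (r (Suc n)) p h A = phase (r n) p h A"
      using phase_change[OF run_step] never by blast
    then show ?case using step(3) by simp
  qed
  obtain t0 where t0: "\<forall>t'\<ge>t0. \<exists>B. witness_blocks P (r t') p h A (quorum P) B"
    using eventually_collected[OF p(3,1) assms(2-4)] unfolding witness_blocks_def by blast
  have "\<exists>s'. ready_step P p h A (r t') s'" if "t' \<ge> max t t0" for t'
  proof -
    obtain B where B: "witness_blocks P (r t') p h A (quorum P) B" using t0 \<open>max t t0 \<le> t'\<close> by auto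
    then have "threshold P \<le> card (dom B)"
      using collected_dom(2) active_setD[OF p(3)] threshold quorum unfolding witness_blocks_def by fastforce
    then obtain D where "D \<subseteq> dom B" "card D = threshold P"
      using obtain_subset_with_card_n by metis
    then have "decoded P B (decode P (B |` D))" unfolding decoded_def by blast
    then show ?thesis
      using B ph[of t'] \<open>max t t0 \<le> t'\<close> p unfolding ready_step_def Let_def by auto
  qed
  then obtain t' where "ready_step P p h A (r t') (r (Suc t'))"
    using fair(3)[OF p(1)] unfolding weakly_fair_def by blast
  then show False using never by blast
qed

text \<open>If \<open>h\<close> is never delivered, the guard of \<open>learn_step\<close> holds
  forever, so fairness forces the delivery.\<close>

lemma eventually_learned:
  assumes "p \<in> correct P F" "p \<notin> A" "active_set P A"
    and "Q \<subseteq> A - F" "quorum P \<le> card Q"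
    and "\<And>q. q \<in> Q \<Longrightarrow> \<exists>b l t. (q, p, Ready h b l) \<in> sent (r t) \<and>
      valid_branch (hash P) (num_active P) h (position A q) b l"
  shows "\<exists>t. h \<in> delivered_roots (r t) p"
proof (rule ccontr)
  assume never: "\<nexists>t. h \<in> delivered_roots (r t) p"
  obtain t where t: "\<forall>t'\<ge>t. \<exists>B. ready_blocks P (r t') p h A (quorum P) B"
    using eventually_collected[OF assms(3,1,4-6)] unfolding ready_blocks_def by blast
  have "\<exists>s'. learn_step P p h (r t') s'" if "t' \<ge> t" for t'
  proof -
    obtain B where B: "ready_blocks P (r t') p h A (quorum P) B" using t \<open>t \<le> t'\<close> by auto
    then have "threshold P \<le> card (dom B)"
      using collected_dom(2) active_setD[OF assms(3)] threshold quorum unfolding ready_blocks_def by fastforce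
    then obtain D where "D \<subseteq> dom B" "card D = threshold P"
      using obtain_subset_with_card_n by metis
    then have "decoded P B (decode P (B |` D))" unfolding decoded_def by blast
    moreover have "p \<in> replicas P - A" using assms(1,2) by (simp add: correct_def)
    ultimately show ?thesis
      using B never assms(3) unfolding learn_step_def by blast
  qed
  then obtain t' where "learn_step P p h (r t') (r (Suc t'))"
    using fair(4)[OF assms(1)] unfolding weakly_fair_def by blast
  then have "h \<in> delivered_roots (r (Suc t')) p" by (auto simp: learn_step_def)
  then show False using never by blast
qed

text \<open>From \<open>5f+1\<close> active replicas at least \<open>4f+1\<close> correct ones
  remain, so progress never waits for faulty replicas.\<close>

lemma quorum_correct: "active_set P A \<Longrightarrow> quorum P \<le> card (A - F)"
  using card_le_card_Diff_add[OF finite_faulty card_faulty, of A] active_setD(3)[of A] num_active quorum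
  by linarith

text \<open>The common core of Agreement and Validity: \<open>3f+1\<close> correct witnesses suffice
  to start the chain interpolation, own witness, ready, delivery.\<close>

lemma eventually_delivered:
  assumes "known h m" "active_set P A" "Q \<subseteq> A - F" "threshold P \<le> card Q" "p \<in> correct P F"
    and "\<And>q. q \<in> Q \<Longrightarrow> \<exists>b l t. (\<forall>x\<in>A. (q, x, Witness h b l A) \<in> sent (r t)) \<and>
      valid_branch (hash P) (num_active P) h (position A q) b l"
  shows "\<exists>t. m \<in> set (delivered (r t) p)"
proof -
  have intp: "\<exists>t. phase (r t) q h A = Interpolated (encode P m)" if "q \<in> A - F" for q
    using that assms(6) correct_activeI[OF assms(2)]
    by (intro eventually_interpolated[OF assms(1) _ _ assms(2-4)]) blast+
  have wit: "\<exists>b l t. (q, x, Witness h b l A) \<in> sent (r t) \<and>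
      valid_branch (hash P) (num_active P) h (position A q) b l" if q: "q \<in> A - F" and x: "x \<in> A" for q x
  proof -
    obtain t m' where "known h m'"
      "(q, x, Witness h (block_branch m' (position A q)) (encode P m' ! position A q) A) \<in> sent (r t)"
      using intp[OF q] interpolatedD x by metis
    then show ?thesis
      using known_valid_branch position_less_num_active[OF assms(2)] q by blast
  qed
  have rdy: "\<exists>t. ready_step P q h A (r t) (r (Suc t))" if q: "q \<in> A - F" for q
    using intp[OF q] eventually_ready_step[OF _ subset_refl quorum_correct[OF assms(2)]] wit q by blast
  have "\<exists>t. h \<in> delivered_roots (r t) p"
  proof (cases "p \<in> A")
    case True
    then obtain t where "ready_step P p h A (r t) (r (Suc t))"
      using rdy assms(5) by (auto simp: correct_def)
    then have "h \<in> delivered_roots (r (Suc t)) p" by (auto simp: ready_step_def Let_def)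
    then show ?thesis by blast
  next
    case False
    have "\<exists>b l t. (q, p, Ready h b l) \<in> sent (r t) \<and>
      valid_branch (hash P) (num_active P) h (position A q) b l" if q: "q \<in> A - F" for q
    proof -
      obtain t where t: "ready_step P q h A (r t) (r (Suc t))" using rdy[OF q] by blast
      obtain m' where m': "known h m'"
        "r (Suc t) = deliver q h m'
           (multicast q (replicas P - A)
             (\<lambda>_. Ready h (block_branch m' (position A q)) (encode P m' ! position A q))
             (set_phase q h A Completed (r t)))"
        using ready_stepD[OF t] by metis
      have "p \<in> replicas P - A" using False assms(5) by (simp add: correct_def)
      then have "(q, p, Ready h (block_branch m' (position A q)) (encode P m' ! position A q)) \<in> sent (r (Suc t))"
        using m'(2) by auto
      then show ?thesis
        using known_valid_branch[OF m'(1)] position_less_num_active[OF assms(2)] q by blast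
    qed
    then show ?thesis
      using eventually_learned[OF assms(5) False assms(2) subset_refl quorum_correct[OF assms(2)]] by blast
  qed
  \<comment> \<open>\<open>p\<close> may have delivered for \<open>h\<close> through another active
    set; uniqueness of the known message still gives \<open>m\<close>.\<close>
  then obtain t where "h \<in> delivered_roots (r t) p" by blast
  then obtain m' where "m' \<in> set (delivered (r t) p)" "known h m'"
    using delivered_roots_known[OF assms(5)] by blast
  then show ?thesis using known_unique[OF assms(1)] by blast
qed

lemma agreement: "rb_agreement (correct P F) (\<lambda>t. delivered (r t))"
  unfolding rb_agreement_def
proof (intro ballI allI impI)
  fix p m t p' assume p: "p \<in> correct P F" "m \<in> set (delivered (r t) p)" and p': "p' \<in> correct P F"
  then obtain h where h: "known h m" "h \<in> delivered_roots (r t) p"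
    using delivered_roots_known[OF p(1), of t] by blast
  then obtain q t' A where q: "q \<in> correct P F" "ready_step P q h A (r t') (r (Suc t'))"
    using delivered_roots_known[OF p(1), of t] by blast
  obtain B where A: "q \<in> A" "active_set P A" and B: "witness_blocks P (r t') q h A (quorum P) B"
    by (rule ready_stepD[OF q(2)]) blast
  obtain Q where Q: "Q \<subseteq> A" "card Q = quorum P"
    "\<forall>x\<in>Q. \<exists>b l. (x, Witness h b l A) \<in> received (r t') q \<and>
       valid_branch (hash P) (num_active P) h (position A x) b l \<and> B (position A x) = Some l"
    using B unfolding witness_blocks_def collected_def by blast
  show "\<exists>t'. m \<in> set (delivered (r t') p')"
  proof (rule eventually_delivered[OF h(1) A(2) _ _ p'])
    show "Q - F \<subseteq> A - F" using Q(1) by blast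
    \<comment> \<open>\<open>4f+1\<close> witnesses minus at most \<open>f\<close> faulty ones leave
      \<open>3f+1\<close>.\<close>
    show "threshold P \<le> card (Q - F)"
      using card_le_card_Diff_add[OF finite_faulty card_faulty, of Q] Q(2) quorum threshold by linarith
    fix x assume x: "x \<in> Q - F"
    then obtain b l where *: "(x, Witness h b l A) \<in> received (r t') q"
      "valid_branch (hash P) (num_active P) h (position A x) b l"
      using Q(3) by (metis DiffD1)
    have "x \<in> correct P F" using x Q(1) correct_activeI[OF A(2)] by blast
    then have "\<forall>y\<in>A. (x, y, Witness h b l A) \<in> sent (r t')"
      using witness_sent[OF received_sent[OF *(1)]] by simp
    then show "\<exists>b l t. (\<forall>y\<in>A. (x, y, Witness h b l A) \<in> sent (r t)) \<and>
        valid_branch (hash P) (num_active P) h (position A x) b l"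
      using *(2) by blast
  qed
qed

lemma validity: "rb_validity (correct P F) (\<lambda>t. broadcasts (r t)) (\<lambda>t. delivered (r t))"
  unfolding rb_validity_def
proof (intro ballI allI impI)
  fix p m t assume p: "p \<in> correct P F" and m: "m \<in> broadcasts (r t) p"
  obtain A where "p = sender P" "length m = threshold P" and A: "active_set P A" and
    init: "\<And>q. q \<in> A \<Longrightarrow> (sender P, q,
      Init (root m) (block_branch m (position A q)) (encode P m ! position A q) A) \<in> sent (r t)"
    using broadcast_init[OF m] by blast
  \<comment> \<open>The correct sender itself hashed the tree of \<open>m\<close>.\<close>
  have known: "known (root m) m" using known_broadcast p m \<open>length m = threshold P\<close> by blast
  show "\<exists>t'. m \<in> set (delivered (r t') p)"
  proof (rule eventually_delivered[OF known A subset_refl _ p])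
    show "threshold P \<le> card (A - F)"
      using quorum_correct[OF A] threshold quorum by linarith
    fix q assume q: "q \<in> A - F"
    let ?b = "block_branch m (position A q)" and ?l = "encode P m ! position A q"
    have C: "q \<in> correct P F" using q correct_activeI[OF A] by blast
    obtain t0 where t0: "(sender P, Init (root m) ?b ?l A) \<in> received (r t0) q"
      using arrival[OF p C] init q \<open>p = sender P\<close> by blast
    \<comment> \<open>Having sent a witness does not disable \<open>witness_step\<close>, so the
      received \<open>Init\<close> keeps it enabled and fairness applies.\<close>
    have "\<exists>s'. witness_step P q (root m) ?b ?l A (r t') s'" if "t' \<ge> t0" for t'
      using t0 run_mono(2)[OF that, of q] A q unfolding witness_step_def by blast
    then obtain t' where "witness_step P q (root m) ?b ?l A (r t') (r (Suc t'))"
      using fair(1)[OF C] unfolding weakly_fair_def by blast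
    then have "\<forall>x\<in>A. (q, x, Witness (root m) ?b ?l A) \<in> sent (r (Suc t'))"
      by (auto simp: witness_step_def)
    then show "\<exists>b l t. (\<forall>x\<in>A. (q, x, Witness (root m) b l A) \<in> sent (r t)) \<and>
        valid_branch (hash P) (num_active P) (root m) (position A q) b l"
      using known_valid_branch[OF known] position_less_num_active[OF A] q by blast
  qed
qed

end

theorem theorem2:
  fixes P :: "('b, 'h) mbcl" and f :: nat and F :: "replica set"
    and r :: "nat \<Rightarrow> ('b, 'h) state"
  assumes "max_faulty P = f"
    and "num_replicas P = 7 * f + 1"
    and "num_active P = 5 * f + 1"
    and "sender P \<in> replicas P"
    and "mds_code (num_active P - 2 * f) (num_active P) (encode P) (decode P)"
    and "F \<subseteq> replicas P" and "card F \<le> f"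
    and "mbcl_run P F r"
    and "no_hash_collision P F r"
  shows "reliable_broadcast (correct P F) (sender P)
           (\<lambda>t. broadcasts (r t)) (\<lambda>t. delivered (r t))"
proof -
  interpret mbcl_execution P f F r
    using assms by unfold_locales
  show ?thesis
    unfolding reliable_broadcast_def using validity agreement integrity by blast
qed

end
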